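(* For any $\epsilon>0$ and even $d\ge4$ there is a $\gamma>0$ such that a random $G\in\mathcal{G}_{n,d}$ is a $\gamma$-spreader with probability $1-O(n^{-\tau_{\mathrm{fund}}})$ as $n\to\infty$.
   Context: $\mathcal{G}_{n,d}$: choose independent uniformly random permutations $\pi_1,\dots,\pi_{d/2}$ of $\{1,\dots,n\}$; $G$ is the $d$-regular multigraph on $\{1,\dots,n\}$ with adjacency matrix $\sum_j(P_{\pi_j}+P_{\pi_j}^{-1})$, with edge $i\to\pi_j(i)$ labelled $\pi_j$ and its reverse labelled $\pi_j^{-1}$. For a set $A$ of vertices, $\Gamma(A)$ is the set of vertices adjacent to some member of $A$; $G$ is a $\gamma$-spreader if $|\Gamma(A)|\ge(1+\gamma)|A|$ for all $A$ with $|A|\le n/2$. $\tau_{\mathrm{fund}}$ is the smallest order of a supercritical tangle: a tangle is a connected labelled graph occurring (label-preservingly, injectively on vertices and edges) in some graph of $\mathcal{G}_{n,d}$ for some $n$; its order is (number of undirected edges) $-$ (number of vertices), each self-loop counting as one edge; it is supercritical if the Perron–Frobenius eigenvalue of its non-backtracking edge graph (vertices: directed edges; $e_1\to e_2$ iff $e_1$ ends where $e_2$ starts and $e_2$ is not the reverse of $e_1$) is at least $\sqrt{d-1}$. *)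

theory Defs
  imports
    "HOL-Probability.Probability"
    "HOL-Library.Landau_Symbols"
    "Graph_Theory.Graph_Theory"
    "Jordan_Normal_Form.Spectral_Radius"
begin

text \<open>
  Labels of directed edges: \<open>Fwd j\<close> stands for \<open>\<pi>\<^sub>j\<close> and \<open>Bwd j\<close> for its inverse.
\<close>

datatype letter = Fwd nat | Bwd nat

fun inv_letter :: "letter \<Rightarrow> letter" where
  "inv_letter (Fwd j) = Bwd j"
| "inv_letter (Bwd j) = Fwd j"

fun act :: "(nat \<Rightarrow> nat \<Rightarrow> nat) \<Rightarrow> letter \<Rightarrow> nat \<Rightarrow> nat" where
  "act \<pi> (Fwd j) i = \<pi> j i"
| "act \<pi> (Bwd j) i = inv_into UNIV (\<pi> j) i"

definition letters :: "nat \<Rightarrow> letter set" where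
  "letters d = Fwd ` {1..d div 2} \<union> Bwd ` {1..d div 2}"

text \<open>
  A labelled (multi)graph is a digraph whose directed edges come in pairs \<open>a\<close>, \<open>reversal T a\<close>,
  one pair for each undirected edge; a self-loop also consists of two directed edges.
  As required by \<^locale>\<open>bidirected_digraph\<close>, the reversal is the identity on non-arcs.
\<close>

record ('a, 'b) labelled_graph =
  shape :: "('a, 'b) pre_digraph"
  reversal :: "'b \<Rightarrow> 'b"
  label :: "'b \<Rightarrow> letter"

definition adjacency_mat :: "('a :: linorder, 'b) pre_digraph \<Rightarrow> complex mat" where
  "adjacency_mat D =
    (let vs = sorted_list_of_set (verts D) in
      Matrix.mat (length vs) (length vs)
        (\<lambda>(i, j). of_nat (card {a \<in> arcs D. tail D a = vs ! i \<and> head D a = vs ! j})))"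

text \<open>
  The Perron-Frobenius eigenvalue of the (entrywise nonnegative) adjacency matrix is its spectral
  radius. The empty matrix has no eigenvalues; its Perron-Frobenius eigenvalue is set to 0.
\<close>

definition pf_eigenvalue :: "('a :: linorder, 'b) pre_digraph \<Rightarrow> real" where
  "pf_eigenvalue D = (if verts D = {} then 0 else spectral_radius (adjacency_mat D))"


subsection \<open>The permutation model\<close>

text \<open>
  The arc \<open>(i, l)\<close> is the one with label \<open>l\<close> leaving \<open>i\<close>. Thus \<open>(i, Fwd j)\<close> goes from \<open>i\<close> to
  \<open>\<pi> j i\<close>, and its reverse is \<open>(\<pi> j i, Bwd j)\<close>.
\<close>

definition perm_graph :: "nat \<Rightarrow> nat \<Rightarrow> (nat \<Rightarrow> nat \<Rightarrow> nat) \<Rightarrow> (nat, nat \<times> letter) labelled_graph"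
  where
  "perm_graph n d \<pi> =
    \<lparr> shape = \<lparr> verts = {1..n}, arcs = {1..n} \<times> letters d,
                tail = fst, head = (\<lambda>(i, l). act \<pi> l i) \<rparr>,
      reversal = (\<lambda>(i, l). if i \<in> {1..n} \<and> l \<in> letters d then (act \<pi> l i, inv_letter l) else (i, l)),
      label = snd \<rparr>"

definition random_graph :: "nat \<Rightarrow> nat \<Rightarrow> (nat, nat \<times> letter) labelled_graph pmf" where
  "random_graph n d =
    map_pmf (perm_graph n d)
      (Pi_pmf {1..d div 2} id (\<lambda>_. pmf_of_set {p. p permutes {1..n}}))"

definition nbhd :: "('a, 'b) pre_digraph \<Rightarrow> 'a set \<Rightarrow> 'a set" where
  "nbhd G A = {w \<in> verts G. \<exists>v\<in>A. v \<rightarrow>\<^bsub>G\<^esub> w}"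

definition spreader :: "real \<Rightarrow> ('a, 'b) pre_digraph \<Rightarrow> bool" where
  "spreader \<gamma> G \<longleftrightarrow>
    (\<forall>A \<subseteq> verts G. real (card A) \<le> real (card (verts G)) / 2 \<longrightarrow>
      real (card (nbhd G A)) \<ge> (1 + \<gamma>) * real (card A))"


subsection \<open>Tangles\<close>

definition occurs_in :: "('a, 'b) labelled_graph \<Rightarrow> ('c, 'e) labelled_graph \<Rightarrow> bool" where
  "occurs_in T G \<longleftrightarrow>
    (\<exists>f g. inj_on f (verts (shape T)) \<and> f ` verts (shape T) \<subseteq> verts (shape G) \<and>
           inj_on g (arcs (shape T)) \<and> g ` arcs (shape T) \<subseteq> arcs (shape G) \<and>
           (\<forall>a \<in> arcs (shape T).
              tail (shape G) (g a) = f (tail (shape T) a) \<and>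
              head (shape G) (g a) = f (head (shape T) a) \<and>
              g (reversal T a) = reversal G (g a) \<and>
              label G (g a) = label T a))"

text \<open>
  Every tangle is finite, so vertices and arcs in \<^typ>\<open>nat\<close> cover all of them up to isomorphism.
\<close>

definition tangle :: "nat \<Rightarrow> (nat, nat) labelled_graph \<Rightarrow> bool" where
  "tangle d T \<longleftrightarrow>
    bidirected_digraph (shape T) (reversal T) \<and> Digraph_Component.connected (shape T) \<and>
    (\<exists>n. \<exists>G \<in> set_pmf (random_graph n d). occurs_in T G)"

definition undirected_edges :: "('a, 'b) labelled_graph \<Rightarrow> 'b set set" where
  "undirected_edges T = (\<lambda>a. {a, reversal T a}) ` arcs (shape T)"

definition tangle_order :: "('a, 'b) labelled_graph \<Rightarrow> int" where
  "tangle_order T = int (card (undirected_edges T)) - int (card (verts (shape T)))"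

definition nonbacktracking_graph :: "('a, 'b) labelled_graph \<Rightarrow> ('b, 'b \<times> 'b) pre_digraph" where
  "nonbacktracking_graph T =
    \<lparr> verts = arcs (shape T),
      arcs = {(e1, e2). e1 \<in> arcs (shape T) \<and> e2 \<in> arcs (shape T) \<and>
                        head (shape T) e1 = tail (shape T) e2 \<and> e2 \<noteq> reversal T e1},
      tail = fst, head = snd \<rparr>"

definition supercritical :: "nat \<Rightarrow> (nat, nat) labelled_graph \<Rightarrow> bool" where
  "supercritical d T \<longleftrightarrow> pf_eigenvalue (nonbacktracking_graph T) \<ge> sqrt (real d - 1)"

definition tau_fund :: "nat \<Rightarrow> int" where
  "tau_fund d = Inf {tangle_order T |T. tangle d T \<and> supercritical d T}"


subsection \<open>Sanity checks on the permutation model\<close>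

lemma bidirected_perm_graph:
  assumes "\<And>j. j \<in> {1..d div 2} \<Longrightarrow> \<pi> j permutes {1..n}"
  shows "bidirected_digraph (shape (perm_graph n d \<pi>)) (reversal (perm_graph n d \<pi>))"
proof -
  have act: "act \<pi> l i \<in> {1..n}" if "i \<in> {1..n}" "l \<in> letters d" for i l
    using that permutes_in_image[OF assms] permutes_in_image[OF permutes_inv[OF assms]]
    by (auto simp: letters_def simp del: atLeastAtMost_iff)
  have inv_l: "inv_letter l \<in> letters d" if "l \<in> letters d" for l
    using that by (auto simp: letters_def)
  have act_inv: "act \<pi> (inv_letter l) (act \<pi> l i) = i" if "l \<in> letters d" for l i
    using that permutes_inverses[OF assms] by (auto simp: letters_def)
  have inv_inv: "inv_letter (inv_letter l) = l" and inv_neq: "inv_letter l \<noteq> l" for l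
    by (cases l; simp)+
  show ?thesis
    by unfold_locales
       (use act inv_l act_inv inv_inv inv_neq in
         \<open>auto simp: perm_graph_def simp del: atLeastAtMost_iff split: if_splits\<close>)
qed

text \<open>The adjacency matrix of the graph is the sum of the permutation matrices and their inverses.\<close>

lemma card_arcs_perm_graph:
  assumes "\<And>j. j \<in> {1..d div 2} \<Longrightarrow> \<pi> j permutes {1..n}" and "u \<in> {1..n}"
  defines "G \<equiv> shape (perm_graph n d \<pi>)"
  shows "card {a \<in> arcs G. tail G a = u \<and> head G a = v} =
    (\<Sum>j = 1..d div 2. of_bool (\<pi> j u = v) + of_bool (\<pi> j v = u))"
proof -
  let ?J = "{1..d div 2}"
  have eq: "{a \<in> arcs G. tail G a = u \<and> head G a = v} =
      (\<lambda>j. (u, Fwd j)) ` {j \<in> ?J. \<pi> j u = v} \<union> (\<lambda>j. (u, Bwd j)) ` {j \<in> ?J. \<pi> j v = u}"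
    (is "?L = ?R")
  proof (rule Set.set_eqI)
    fix a :: "nat \<times> letter"
    obtain i l where a: "a = (i, l)" by fastforce
    have letter: "Fwd j \<in> letters d \<longleftrightarrow> j \<in> ?J" "Bwd j \<in> letters d \<longleftrightarrow> j \<in> ?J" for j
      by (auto simp: letters_def)
    have arc: "a \<in> ?L \<longleftrightarrow> i = u \<and> l \<in> letters d \<and> act \<pi> l u = v"
      using assms(2) unfolding a G_def perm_graph_def by (simp del: atLeastAtMost_iff) metis
    show "a \<in> ?L \<longleftrightarrow> a \<in> ?R"
    proof (cases l)
      case (Fwd j)
      then show ?thesis
        unfolding arc unfolding a Fwd letter act.simps by blast
    next
      case (Bwd j)
      have "j \<in> ?J \<and> inv_into UNIV (\<pi> j) u = v \<longleftrightarrow> j \<in> ?J \<and> \<pi> j v = u"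
        using permutes_inv_eq[OF assms(1), of j u v] by argo
      then have "a \<in> ?L \<longleftrightarrow> i = u \<and> j \<in> ?J \<and> \<pi> j v = u"
        unfolding arc unfolding Bwd letter act.simps by blast
      then show ?thesis
        unfolding a Bwd by blast
    qed
  qed
  have "card {a \<in> arcs G. tail G a = u \<and> head G a = v} = card ((\<lambda>j. (u, Fwd j)) ` {j \<in> ?J. \<pi> j u = v}) +
      card ((\<lambda>j. (u, Bwd j)) ` {j \<in> ?J. \<pi> j v = u})"
    unfolding eq by (rule card_Un_disjoint) auto
  also have "\<dots> = card {j \<in> ?J. \<pi> j u = v} + card {j \<in> ?J. \<pi> j v = u}"
    by (simp add: card_image inj_on_def)
  also have "\<dots> = (\<Sum>j\<in>?J. of_bool (\<pi> j u = v) + of_bool (\<pi> j v = u))"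
    by (simp add: sum.distrib of_bool_def sum.If_cases Int_def)
  finally show ?thesis .
qed

end

theory Submission
  imports Defs
begin

text \<open>
  The bouquet of \<open>d/2\<close> loops is a supercritical tangle of order \<open>d/2 - 1\<close>, so it suffices to bound the
  failure probability by \<open>O(n\<^sup>-\<^sup>m)\<close> with \<open>m = d/2 - 1\<close>. If \<open>A\<close> violates the spreading condition and
  \<open>B = \<Gamma>(A)\<close>, then every \<open>\<pi>\<^sub>j\<close> and its inverse map \<open>A\<close> into \<open>B\<close>. For one permutation, let \<open>p(A, B)\<close> be the
  probability of this event; the union bound is the sum of \<open>p(A, B)\<^sup>m\<^sup>+\<^sup>1\<close>. When \<open>|B| = |A|\<close>, the number of
  pairs \<open>(A, B)\<close> with given \<open>|A \<inter> B|\<close> and \<open>|A - B|\<close> is a multinomial coefficient and \<open>p(A, B)\<close> is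
  its reciprocal, so one factor \<open>p\<close> pays for the choice of \<open>(A, B)\<close> and the remaining \<open>m\<close> factors
  contribute at most \<open>C(n, |A|)\<^sup>-\<^sup>m\<close>. An excess \<open>r = |B| - |A|\<close> costs only powers of \<open>C(n, r)\<close>, which
  \<open>C(n, |A|)\<close> absorbs when \<open>r\<close> is a small fraction of \<open>|A|\<close>.
\<close>

subsection \<open>The order of the fundamental tangle\<close>

text \<open>A walk from a vertex of \<open>S\<close> to one outside must cross the boundary.
  Symmetry of the arcs turns weak connectedness into the reachability that provides the
  walk.\<close>

lemma (in bidirected_digraph) exists_leaving_arc:
  assumes "Digraph_Component.connected G" "S \<subset> verts G" "S \<noteq> {}"
  obtains a where "a \<in> arcs G" "tail G a \<in> S" "head G a \<in> verts G - S"
proof -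
  obtain u v where u: "u \<in> S" and v: "v \<in> verts G" "v \<notin> S" using assms(2,3) by blast
  have "strongly_connected G"
    using symmetric_connected_imp_strongly_connected[OF sym_arcs assms(1)] .
  then have "u \<rightarrow>\<^sup>*\<^bsub>G\<^esub> v" using u v assms(2) by (auto simp: strongly_connected_def)
  then have "\<exists>a. a \<in> arcs G \<and> tail G a \<in> S \<and> head G a \<in> verts G - S"
    using v(2)
  proof (induction rule: reachable_induct)
    case base
    then show ?case using u by simp
  next
    case (step x y)
    show ?case
    proof (cases "x \<in> S")
      case True
      from step.hyps have "(x, y) \<in> arcs_ends G" by simp
      then obtain a where "a \<in> arcs G" "tail G a = x" "head G a = y"
        unfolding arcs_ends_conv by blast
      then show ?thesis using True step.prems head_in_verts by blast
    qed (use step in simp)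
  qed
  then show ?thesis using that by blast
qed

text \<open>Grow a spanning tree: from a single vertex on, an arc leaving the current set brings one
  new vertex and at least one new undirected edge.\<close>

lemma card_verts_le_undirected_edges:
  fixes T :: "('a, 'b) labelled_graph"
  assumes bi: "bidirected_digraph (shape T) (reversal T)"
    and con: "Digraph_Component.connected (shape T)"
    and finA: "finite (arcs (shape T))"
  shows "card (verts (shape T)) \<le> card (undirected_edges T) + 1"
proof (cases "finite (verts (shape T))")
  case False
  \<comment> \<open>\<open>card\<close> of an infinite set is 0.\<close>
  then show ?thesis by simp
next
  case finV: True
  interpret bidirected_digraph "shape T" "reversal T" by fact
  let ?V = "verts (shape T)"
  let ?in = "\<lambda>S. {a \<in> arcs (shape T). tail (shape T) a \<in> S \<and> head (shape T) a \<in> S}"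
  let ?E = "\<lambda>S. (\<lambda>a. {a, reversal T a}) ` ?in S"
  have finE: "finite (?E S)" for S using finA by simp
  have "?V \<noteq> {}" using con by (simp add: connected_conv)
  then obtain v0 where v0: "v0 \<in> ?V" by blast
  have "\<exists>S \<subseteq> ?V. card S = Suc i \<and> card (?E S) \<ge> i" if "Suc i \<le> card ?V" for i
    using that
  proof (induction i)
    case 0
    show ?case using v0 by (intro exI[of _ "{v0}"]) auto
  next
    case (Suc i)
    then obtain S where S: "S \<subseteq> ?V" "card S = Suc i" "card (?E S) \<ge> i" by auto
    then have "S \<subset> ?V" "S \<noteq> {}" using Suc.prems by auto
    then obtain a where a: "a \<in> arcs (shape T)" "tail (shape T) a \<in> S" "head (shape T) a \<in> ?V - S"
      using exists_leaving_arc[OF con] by blast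
    let ?S = "insert (head (shape T) a) S"
    have "insert {a, reversal T a} (?E S) \<subseteq> ?E ?S" using a by auto
    then have "card (insert {a, reversal T a} (?E S)) \<le> card (?E ?S)"
      by (rule card_mono[OF finE])
    \<comment> \<open>Edges already counted have both ends in \<open>S\<close>, but the head of
      \<open>a\<close> lies outside.\<close>
    moreover have "{a, reversal T a} \<notin> ?E S" using a by (auto simp: doubleton_eq_iff)
    ultimately have "card (?E ?S) \<ge> Suc i" using S(3) finE by simp
    moreover have "card ?S = Suc (Suc i)" using a S finite_subset[OF S(1) finV] by simp
    ultimately show ?case using a S by (intro exI[of _ ?S]) auto
  qed
  note grow = this
  have "card ?V > 0" using v0 finV by (auto simp: card_gt_0_iff)
  then have "\<exists>S \<subseteq> ?V. card S = Suc (card ?V - 1) \<and> card (?E S) \<ge> card ?V - 1"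
    by (intro grow) simp
  then obtain S where S: "S \<subseteq> ?V" "card (?E S) \<ge> card ?V - 1" by blast
  have "card (?E S) \<le> card (undirected_edges T)"
    unfolding undirected_edges_def using finA by (intro card_mono) auto
  with S show ?thesis by simp
qed

lemma set_pmf_random_graph:
  "set_pmf (random_graph n d) =
     perm_graph n d ` PiE_dflt {1..d div 2} id (\<lambda>_. {p. p permutes {1..n}})"
proof -
  have "id permutes {1..n}" by (simp add: permutes_id)
  then have "{p. p permutes {1..n}} \<noteq> {}" by blast
  then have "set_pmf (pmf_of_set {p. p permutes {1..n}}) = {p. p permutes {1..n}}"
    by (rule set_pmf_of_set) (simp add: finite_permutations)
  then show ?thesis
    by (simp add: random_graph_def set_Pi_pmf o_def)
qed

text \<open>\<open>tau_fund\<close> is an infimum of integers, so comparing it with the order of one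
  particular tangle requires a lower bound on all orders. Trees attain -1.\<close>

lemma tangle_order_ge:
  assumes "tangle d T"
  shows "tangle_order T \<ge> - 1"
proof -
  obtain n G where G: "G \<in> set_pmf (random_graph n d)" "occurs_in T G"
    using assms by (auto simp: tangle_def)
  have "finite (arcs (shape G))"
    using G(1) by (auto simp: set_pmf_random_graph perm_graph_def letters_def)
  moreover obtain g where "inj_on g (arcs (shape T))" "g ` arcs (shape T) \<subseteq> arcs (shape G)"
    using G(2) unfolding occurs_in_def by blast
  ultimately have "finite (arcs (shape T))"
    using inj_on_finite by blast
  then show ?thesis
    using card_verts_le_undirected_edges[of T] assms by (simp add: tangle_def tangle_order_def)
qed

section \<open>The bouquet of loops as a supercritical tangle\<close>

text \<open>For even \<open>d\<close>, the arcs \<open>2 * j\<close> and \<open>2 * j + 1\<close>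
  are the two directions of one loop; the shift by \<open>Suc\<close> in the labels is due to
  permutations being numbered from 1.\<close>

definition bouquet :: "nat \<Rightarrow> (nat, nat) labelled_graph" where
  "bouquet d =
    \<lparr> shape = \<lparr> verts = {0}, arcs = {..<d}, tail = (\<lambda>_. 0), head = (\<lambda>_. 0) \<rparr>,
      reversal = (\<lambda>a. if a < d then if even a then Suc a else a - 1 else a),
      label = (\<lambda>a. if even a then Fwd (Suc (a div 2)) else Bwd (Suc (a div 2))) \<rparr>"

lemma bouquet_arc_cases:
  assumes "even d" "a < d"
  obtains j where "j < d div 2" "a = 2 * j" | j where "j < d div 2" "a = Suc (2 * j)"
proof -
  have "a div 2 < d div 2" using assms by presburger
  moreover have "a = 2 * (a div 2) \<or> a = Suc (2 * (a div 2))" by presburger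
  ultimately show ?thesis using that by blast
qed

lemma reversal_bouquet:
  assumes "j < d div 2"
  shows "reversal (bouquet d) (2 * j) = Suc (2 * j)" "reversal (bouquet d) (Suc (2 * j)) = 2 * j"
  using assms by (auto simp: bouquet_def)

lemma label_bouquet:
  "label (bouquet d) (2 * j) = Fwd (Suc j)" "label (bouquet d) (Suc (2 * j)) = Bwd (Suc j)"
  by (auto simp: bouquet_def)

lemma shape_bouquet:
  "shape (bouquet d) = \<lparr> verts = {0}, arcs = {..<d}, tail = (\<lambda>_. 0), head = (\<lambda>_. 0) \<rparr>"
  by (simp add: bouquet_def)

lemma tangle_bouquet:
  assumes "even d"
  shows "tangle d (bouquet d)"
proof -
  have bi: "bidirected_digraph (shape (bouquet d)) (reversal (bouquet d))"
  proof (intro wf_digraph.bidirected_digraphI)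
    show "wf_digraph (shape (bouquet d))"
      by unfold_locales (simp_all add: shape_bouquet)
    fix a
    show "reversal (bouquet d) a = a" if "a \<notin> arcs (shape (bouquet d))"
      using that by (simp add: bouquet_def)
    assume "a \<in> arcs (shape (bouquet d))"
    then have "a < d" by (simp add: shape_bouquet)
    then show "reversal (bouquet d) a \<noteq> a" "reversal (bouquet d) (reversal (bouquet d) a) = a"
      by (cases rule: bouquet_arc_cases[OF assms]; simp add: reversal_bouquet)+
  qed (simp add: shape_bouquet)
  have con: "Digraph_Component.connected (shape (bouquet d))"
    by (simp add: connected_conv shape_bouquet)
  \<comment> \<open>On one vertex all permutations are the identity, so the model graph is itself
    the bouquet.\<close>
  let ?G = "perm_graph 1 d (\<lambda>_. id)"
  have G: "?G \<in> set_pmf (random_graph 1 d)"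
    by (auto simp: set_pmf_random_graph PiE_dflt_def permutes_id)
  have "occurs_in (bouquet d) ?G"
    unfolding occurs_in_def
  proof (intro exI conjI)
    let ?f = "\<lambda>_::nat. 1::nat" and ?g = "\<lambda>a. (1::nat, label (bouquet d) a)"
    show "inj_on ?f (verts (shape (bouquet d)))" "?f ` verts (shape (bouquet d)) \<subseteq> verts (shape ?G)"
      by (simp_all add: shape_bouquet perm_graph_def)
    show "inj_on ?g (arcs (shape (bouquet d)))"
    proof (rule inj_onI)
      fix a b assume "a \<in> arcs (shape (bouquet d))" "b \<in> arcs (shape (bouquet d))" and eq: "?g a = ?g b"
      then have "a < d" "b < d" by (simp_all add: shape_bouquet)
      then show "a = b" using eq
        by (cases a rule: bouquet_arc_cases[OF assms]; cases b rule: bouquet_arc_cases[OF assms])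
          (simp_all add: label_bouquet)
    qed
    have lab: "label (bouquet d) a \<in> letters d" if "a < d" for a
      using that by (cases rule: bouquet_arc_cases[OF assms]) (auto simp: label_bouquet letters_def)
    then show "?g ` arcs (shape (bouquet d)) \<subseteq> arcs (shape ?G)"
      by (auto simp: shape_bouquet perm_graph_def)
    have act: "act (\<lambda>_. id) l 1 = 1" for l
      by (cases l) (auto simp: inv_into_def)
    have inv: "label (bouquet d) (reversal (bouquet d) a) = inv_letter (label (bouquet d) a)" if "a < d" for a
      using that by (cases rule: bouquet_arc_cases[OF assms]) (auto simp: label_bouquet reversal_bouquet)
    show "\<forall>a\<in>arcs (shape (bouquet d)).
       tail (shape ?G) (?g a) = ?f (tail (shape (bouquet d)) a) \<and>
       head (shape ?G) (?g a) = ?f (head (shape (bouquet d)) a) \<and>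
       ?g (reversal (bouquet d) a) = reversal ?G (?g a) \<and>
       label ?G (?g a) = label (bouquet d) a"
    proof
      fix a assume "a \<in> arcs (shape (bouquet d))"
      then have "a < d" by (simp add: bouquet_def)
      then show "tail (shape ?G) (?g a) = ?f (tail (shape (bouquet d)) a) \<and>
       head (shape ?G) (?g a) = ?f (head (shape (bouquet d)) a) \<and>
       ?g (reversal (bouquet d) a) = reversal ?G (?g a) \<and>
       label ?G (?g a) = label (bouquet d) a"
        using lab[of a] inv[of a] act by (simp add: perm_graph_def shape_bouquet)
    qed
  qed
  with bi con G show ?thesis unfolding tangle_def by blast
qed

lemma tangle_order_bouquet:
  assumes "even d"
  shows "tangle_order (bouquet d) = int (d div 2) - 1"
proof -
  have "undirected_edges (bouquet d) = (\<lambda>j. {2 * j, Suc (2 * j)}) ` {..<d div 2}"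
    unfolding undirected_edges_def
  proof (intro equalityI subsetI)
    fix e assume "e \<in> (\<lambda>a. {a, reversal (bouquet d) a}) ` arcs (shape (bouquet d))"
    then obtain a where a: "a < d" "e = {a, reversal (bouquet d) a}" by (auto simp: shape_bouquet)
    from a(1) show "e \<in> (\<lambda>j. {2 * j, Suc (2 * j)}) ` {..<d div 2}"
      by (cases rule: bouquet_arc_cases[OF assms]) (auto simp: a(2) reversal_bouquet)
  next
    fix e assume "e \<in> (\<lambda>j. {2 * j, Suc (2 * j)}) ` {..<d div 2}"
    then obtain j where "j < d div 2" "e = {2 * j, Suc (2 * j)}" by auto
    then show "e \<in> (\<lambda>a. {a, reversal (bouquet d) a}) ` arcs (shape (bouquet d))"
      by (intro image_eqI[of _ _ "2 * j"]) (auto simp: reversal_bouquet shape_bouquet)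
  qed
  moreover have "inj_on (\<lambda>j::nat. {2 * j, Suc (2 * j)}) {..<d div 2}"
  proof (rule inj_onI)
    fix j k :: nat assume "{2 * j, Suc (2 * j)} = {2 * k, Suc (2 * k)}"
    then have "2 * j = 2 * k \<or> 2 * j = Suc (2 * k)" by blast
    then show "j = k" by presburger
  qed
  ultimately show ?thesis
    by (simp add: tangle_order_def card_image shape_bouquet)
qed

text \<open>Every arc of the bouquet can be followed by every arc except its own reverse. All row
  sums are therefore \<open>d - 1\<close>, the all-ones vector is an eigenvector, and the spectral
  radius is at least \<open>d - 1\<close>, which is at least its square root.\<close>

lemma supercritical_bouquet:
  assumes "even d" "d \<ge> 2"
  shows "supercritical d (bouquet d)"
proof -
  let ?D = "nonbacktracking_graph (bouquet d)"
  let ?rev = "reversal (bouquet d)"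
  let ?A = "adjacency_mat ?D"
  define v :: "complex vec" where "v = Matrix.vec d (\<lambda>_. 1)"
  have vs: "sorted_list_of_set (verts ?D) = [0..<d]"
    by (simp add: nonbacktracking_graph_def shape_bouquet lessThan_atLeast0)
  have arcs: "{a \<in> arcs ?D. tail ?D a = i \<and> head ?D a = j} = (if j \<noteq> ?rev i then {(i, j)} else {})"
    if "i < d" "j < d" for i j
    using that by (auto simp: nonbacktracking_graph_def shape_bouquet)
  have A: "?A = Matrix.mat d d (\<lambda>(i, j). if j \<noteq> ?rev i then 1 else 0)"
    unfolding adjacency_mat_def Let_def vs by (rule eq_matI) (auto simp: arcs)
  have carr: "?A \<in> carrier_mat d d" by (simp add: A)
  have rev_less: "?rev i < d" if "i < d" for i
    using that by (cases rule: bouquet_arc_cases[OF assms(1)]) (auto simp: reversal_bouquet)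
  have "?A *\<^sub>v v = of_nat (d - 1) \<cdot>\<^sub>v v"
  proof (rule eq_vecI)
    fix i assume "i < dim_vec (of_nat (d - 1) \<cdot>\<^sub>v v)"
    then have i: "i < d" by (simp add: v_def)
    have "vec_index (?A *\<^sub>v v) i = (\<Sum>j\<in>{0..<d}. if j \<noteq> ?rev i then 1 else 0)"
      using i by (simp add: A v_def scalar_prod_def)
    also have "\<dots> = (\<Sum>j\<in>{0..<d} - {?rev i}. 1)"
      by (rule sum.mono_neutral_cong_right) auto
    also have "\<dots> = of_nat (card ({0..<d} - {?rev i}))" by simp
    also have "\<dots> = of_nat (d - 1)" using rev_less[OF i] by simp
    finally show "vec_index (?A *\<^sub>v v) i = vec_index (of_nat (d - 1) \<cdot>\<^sub>v v) i" using i by (simp add: v_def)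
  qed (simp add: A v_def)
  moreover have "v \<noteq> 0\<^sub>v d"
  proof
    assume "v = 0\<^sub>v d"
    then have "vec_index v 0 = 0" using assms by simp
    then show False using assms by (simp add: v_def)
  qed
  ultimately have "eigenvector ?A v (of_nat (d - 1))"
    using carr by (auto simp: eigenvector_def v_def)
  then have "of_nat (d - 1) \<in> spectrum ?A" by (auto simp: spectrum_def eigenvalue_def)
  then have "norm (of_nat (d - 1) :: complex) \<le> spectral_radius ?A"
    using spectral_radius_mem_max(2)[OF carr] assms by auto
  moreover have "norm (of_nat (d - 1) :: complex) = real d - 1"
    unfolding norm_of_nat using assms by (simp add: of_nat_diff)
  moreover have "0 \<in> verts ?D" using assms by (simp add: nonbacktracking_graph_def shape_bouquet)
  moreover have "sqrt (real d - 1) \<le> real d - 1"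
    using assms by (intro real_le_lsqrt) (auto simp: power2_eq_square)
  ultimately show ?thesis
    unfolding supercritical_def pf_eigenvalue_def by auto
qed

lemma tau_fund_le:
  assumes "even d" "d \<ge> 2"
  shows "tau_fund d \<le> int (d div 2) - 1"
  unfolding tau_fund_def
proof (rule cInf_lower)
  show "int (d div 2) - 1 \<in> {tangle_order T |T. tangle d T \<and> supercritical d T}"
    using tangle_bouquet[OF assms(1)] supercritical_bouquet[OF assms]
      tangle_order_bouquet[OF assms(1), symmetric] by blast
  show "bdd_below {tangle_order T |T. tangle d T \<and> supercritical d T}"
    using tangle_order_ge by (auto intro!: bdd_belowI[of _ "-1"])
qed

subsection \<open>Permutations mapping one set into another in both directions\<close>

text \<open>The falling product counts the injections from \<open>s\<close> points into
  \<open>c'\<close> points. Truncated subtraction is harmless: for \<open>s > c'\<close> one of the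
  factors is zero.\<close>

lemma falling_prod_mult_fact_le:
  fixes c c' s :: nat
  assumes "c' \<le> c"
  shows "prod ((-) c') {0..<s} * fact (c - s) \<le> (fact c :: nat)"
proof (induction s)
  case (Suc s)
  have "(c' - s) * fact (c - Suc s) \<le> (fact (c - s) :: nat)"
  proof (cases "c - s")
    case (Suc j)
    then have "c - Suc s = j" by simp
    with Suc assms show ?thesis by (simp del: mult_Suc)
  qed (use assms in simp)
  then have "prod ((-) c') {0..<s} * ((c' - s) * fact (c - Suc s))
      \<le> prod ((-) c') {0..<s} * (fact (c - s) :: nat)"
    by (rule mult_left_mono) simp
  also have "\<dots> \<le> fact c" by (rule Suc.IH)
  finally show ?case by (simp add: mult.assoc)
qed simp

text \<open>Permutations are counted block by block: once the images of \<open>T\<close> are fixed,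
  the images of \<open>S\<close> form an injection into the free part of \<open>D\<close>, which has
  at most \<open>c\<close> elements. Chaining the estimate over disjoint blocks bounds
  \<open>Q\<close>.\<close>

lemma card_restrict_extend:
  fixes Q :: "('a \<Rightarrow> 'a) set" and c :: nat
  assumes "finite Q" "finite D" "finite S" "T \<inter> S = {}"
    and inj: "\<And>p. p \<in> Q \<Longrightarrow> inj_on p (T \<union> S)"
    and sub: "\<And>p. p \<in> Q \<Longrightarrow> p ` S \<subseteq> D"
    and free: "\<And>p. p \<in> Q \<Longrightarrow> card (D - p ` T) \<le> c"
  shows "card ((\<lambda>p. restrict p (T \<union> S)) ` Q) * fact (c - card S)
           \<le> card ((\<lambda>p. restrict p T) ` Q) * fact c"
proof -
  let ?R = "(\<lambda>p. restrict p T) ` Q"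
  \<comment> \<open>The candidate extensions to \<open>S\<close> of a partial map \<open>g\<close>
    on \<open>T\<close>.\<close>
  define E where "E g = {h \<in> S \<rightarrow>\<^sub>E (D - g ` T). inj_on h S}" for g :: "'a \<Rightarrow> 'a"
  have finE: "finite (E g)" for g
  proof (rule finite_subset)
    show "E g \<subseteq> S \<rightarrow>\<^sub>E D" unfolding E_def by (blast dest: PiE_mono[of S "\<lambda>_. D - g ` T" "\<lambda>_. D", THEN subsetD, rotated])
    show "finite (S \<rightarrow>\<^sub>E D)" using assms(2,3) by (intro finite_PiE)
  qed
  have fin: "finite (Sigma ?R E)"
    using assms(1) finE by (intro finite_SigmaI finite_imageI)
  have "card ((\<lambda>p. restrict p (T \<union> S)) ` Q) \<le> card (Sigma ?R E)"
  proof (rule card_inj_on_le[OF _ _ fin])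
    let ?\<Phi> = "\<lambda>f. (restrict f T, restrict f S)"
    show "inj_on ?\<Phi> ((\<lambda>p. restrict p (T \<union> S)) ` Q)"
    proof (rule inj_onI)
      fix f g assume f: "f \<in> (\<lambda>p. restrict p (T \<union> S)) ` Q"
        and g: "g \<in> (\<lambda>p. restrict p (T \<union> S)) ` Q" and eq: "?\<Phi> f = ?\<Phi> g"
      have "f x = g x" for x
      proof (cases "x \<in> T \<union> S")
        case True
        from eq have "restrict f T x = restrict g T x" "restrict f S x = restrict g S x" by simp_all
        then show ?thesis using True by (auto split: if_splits)
      qed (use f g in auto)
      then show "f = g" by blast
    qed
    show "?\<Phi> ` (\<lambda>p. restrict p (T \<union> S)) ` Q \<subseteq> Sigma ?R E"
    proof
      fix y assume "y \<in> ?\<Phi> ` (\<lambda>p. restrict p (T \<union> S)) ` Q"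
      then obtain p where p: "p \<in> Q" and y: "y = ?\<Phi> (restrict p (T \<union> S))" by blast
      have 1: "restrict (restrict p (T \<union> S)) T = restrict p T"
        and 2: "restrict (restrict p (T \<union> S)) S = restrict p S"
        by (auto simp: fun_eq_iff restrict_def)
      have "restrict p S \<in> E (restrict p T)"
        using inj[OF p] sub[OF p] assms(4) unfolding E_def
        by (auto simp: inj_on_def image_iff)
      then show "y \<in> Sigma ?R E"
        using p unfolding y 1 2 by blast
    qed
  qed
  also have "card (Sigma ?R E) = (\<Sum>g\<in>?R. card (E g))"
    using assms(1) finE by (intro card_SigmaI) auto
  finally have "card ((\<lambda>p. restrict p (T \<union> S)) ` Q) * fact (c - card S)
      \<le> (\<Sum>g\<in>?R. card (E g) * fact (c - card S))"
    by (simp add: sum_distrib_right[symmetric])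
  also have "\<dots> \<le> (\<Sum>g\<in>?R. fact c)"
  proof (rule sum_mono)
    fix g assume "g \<in> ?R"
    then obtain p where p: "p \<in> Q" "g = restrict p T" by blast
    have "card (E g) = prod ((-) (card (D - g ` T))) {0..<card S}"
      unfolding E_def using assms(2,3) by (subst card_inj_on_subset_funcset) auto
    moreover have "g ` T = p ` T" using p by auto
    ultimately show "card (E g) * fact (c - card S) \<le> fact c"
      using falling_prod_mult_fact_le[OF free[OF p(1)], of "card S"] by simp
  qed
  finally show ?thesis by simp
qed

lemma card_restrict_permutes:
  assumes "\<And>p. p \<in> Q \<Longrightarrow> p permutes V"
  shows "card ((\<lambda>p. restrict p V) ` Q) = card Q"
proof (rule card_image, rule inj_onI)
  fix p q assume pq: "p \<in> Q" "q \<in> Q" "restrict p V = restrict q V"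
  show "p = q"
  proof
    fix x
    show "p x = q x"
      using assms[OF pq(1)] assms[OF pq(2)] fun_cong[OF pq(3), of x]
      by (cases "x \<in> V") (auto simp: permutes_def)
  qed
qed

definition trapping :: "'a set \<Rightarrow> 'a set \<Rightarrow> 'a set \<Rightarrow> ('a \<Rightarrow> 'a) set" where
  "trapping V A B = {p. p permutes V \<and> p ` A \<subseteq> B \<and> inv_into UNIV p ` A \<subseteq> B}"

lemma finite_trapping: "finite V \<Longrightarrow> finite (trapping V A B)"
  by (rule finite_subset[OF _ finite_permutations[of V]]) (auto simp: trapping_def)

text \<open>With k = |A| and n = |V|, the images of \<open>A\<close> form an injection into
  \<open>B\<close>, at most (k+r)!/r! choices; the other points then have at most (n-k)!
  choices.\<close>

lemma card_trapping_le:
  assumes "finite V" "A \<subseteq> V" "B \<subseteq> V" "card B = card A + r"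
  shows "card (trapping V A B) * fact r \<le> (fact (card A + r) * fact (card V - card A) :: nat)"
proof -
  let ?Q = "trapping V A B"
  have fin: "finite A" "finite B" "finite (V - A)" using assms finite_subset by auto
  note Q = finite_trapping[OF assms(1), of A B]
  have per: "p permutes V" if "p \<in> ?Q" for p using that by (simp add: trapping_def)
  have inj: "inj_on p U" if "p \<in> ?Q" for p U
    using permutes_inj[OF per[OF that]] by (rule inj_on_subset) simp
  have "card ((\<lambda>p. restrict p ({} \<union> A)) ` ?Q) * fact (card B - card A)
      \<le> card ((\<lambda>p. restrict p {}) ` ?Q) * fact (card B)"
    by (rule card_restrict_extend[OF Q fin(2) fin(1)]) (auto simp: inj, auto simp: trapping_def)
  \<comment> \<open>All restrictions to the empty set coincide, which starts the chain of
    blocks.\<close>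
  also have "card ((\<lambda>p. restrict p {}) ` ?Q) \<le> 1"
    by (rule order.trans[OF card_mono[of "{\<lambda>_. undefined}"]]) auto
  finally have 1: "card ((\<lambda>p. restrict p A) ` ?Q) * fact r \<le> (fact (card A + r) :: nat)"
    using assms by simp
  have "card ((\<lambda>p. restrict p (A \<union> (V - A))) ` ?Q) * fact ((card V - card A) - card (V - A))
      \<le> card ((\<lambda>p. restrict p A) ` ?Q) * fact (card V - card A)"
  proof (rule card_restrict_extend[OF Q assms(1) fin(3)])
    show "p ` (V - A) \<subseteq> V" if "p \<in> ?Q" for p
      using per[OF that] by (auto simp: permutes_in_image)
    show "card (V - p ` A) \<le> card V - card A" if "p \<in> ?Q" for p
      using card_image[OF inj[OF that, of A]] per[OF that] assms
      by (subst card_Diff_subset) (auto simp: permutes_in_image fin)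
  qed (auto simp: inj)
  also have "A \<union> (V - A) = V" using assms by auto
  also have "card ((\<lambda>p. restrict p V) ` ?Q) = card ?Q"
    by (rule card_restrict_permutes) (rule per)
  also have "card (V - A) = card V - card A"
    using assms fin by (simp add: card_Diff_subset)
  finally have "card ?Q \<le> card ((\<lambda>p. restrict p A) ` ?Q) * fact (card V - card A)"
    by (simp only: diff_self_eq_0 fact_0 mult_1_right)
  then have "card ?Q * fact r \<le> card ((\<lambda>p. restrict p A) ` ?Q) * fact (card V - card A) * fact r"
    by simp
  also have "\<dots> \<le> fact (card A + r) * fact (card V - card A)"
    using 1 by (simp add: mult.commute mult.left_commute)
  finally show ?thesis .
qed

text \<open>
  With \<open>A = X \<union> Y\<close> and \<open>B = X \<union> Z\<close>, such a permutation maps \<open>Y\<close> into \<open>Z\<close>, \<open>X\<close> into \<open>X \<union> Z\<close> and \<open>W\<close> into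
  \<open>W \<union> Z\<close>. Choosing the images in the order \<open>Y, X, W, Z\<close> is what makes the bound sharp for \<open>r = 0\<close>.
\<close>

lemma card_trapping_le_type:
  assumes fin: "finite X" "finite Y" "finite Z" "finite W"
    and disj: "X \<inter> Y = {}" "X \<inter> Z = {}" "X \<inter> W = {}" "Y \<inter> Z = {}" "Y \<inter> W = {}" "Z \<inter> W = {}"
    and cZ: "card Z = card Y + r"
  shows "card (trapping (X \<union> Y \<union> Z \<union> W) (X \<union> Y) (X \<union> Z)) * fact r ^ 3
      \<le> (fact (card Y + r) ^ 2 * fact (card X + r) * fact (card W + r) :: nat)"
proof -
  let ?V = "X \<union> Y \<union> Z \<union> W"
  let ?Q = "trapping ?V (X \<union> Y) (X \<union> Z)"
  let ?R = "\<lambda>U. card ((\<lambda>p. restrict p U) ` ?Q)"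
  have finV: "finite ?V" using fin by simp
  note Q = finite_trapping[OF finV, of "X \<union> Y" "X \<union> Z"]
  have per: "p permutes ?V" if "p \<in> ?Q" for p using that by (simp add: trapping_def)
  have inj: "inj_on p U" if "p \<in> ?Q" for p U
    using permutes_inj[OF per[OF that]] by (rule inj_on_subset) simp
  have inV: "p x \<in> ?V \<longleftrightarrow> x \<in> ?V" if "p \<in> ?Q" for p x
    using permutes_in_image[OF per[OF that]] .
  have fwd: "p x \<in> X \<union> Z" if "p \<in> ?Q" "x \<in> X \<union> Y" for p x
    using that by (auto simp: trapping_def)
  have bwd: "x \<in> X \<union> Z" if "p \<in> ?Q" "p x \<in> X \<union> Y" for p x
  proof -
    have "inv_into UNIV p (p x) \<in> X \<union> Z" using that unfolding trapping_def by blast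
    then show ?thesis using permutes_inverses(2)[OF per[OF that(1)]] by simp
  qed
  \<comment> \<open>A value in \<open>X\<close> would have its preimage in
    \<open>X \<union> Z\<close>, which is disjoint from \<open>Y\<close>.\<close>
  have Y: "p ` Y \<subseteq> Z" if "p \<in> ?Q" for p
  proof
    fix y assume "y \<in> p ` Y"
    then obtain x where x: "x \<in> Y" "y = p x" by auto
    then have "y \<in> X \<union> Z" using fwd[OF that, of x] by simp
    moreover have "y \<notin> X" using bwd[OF that, of x] x disj by blast
    ultimately show "y \<in> Z" by simp
  qed
  \<comment> \<open>Likewise, preimages of \<open>X \<union> Y\<close> lie in
    \<open>X \<union> Z\<close>, so no point of \<open>W\<close> lands there.\<close>
  have W: "p ` W \<subseteq> W \<union> Z" if "p \<in> ?Q" for p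
  proof
    fix y assume "y \<in> p ` W"
    then obtain x where x: "x \<in> W" "y = p x" by auto
    then have "y \<in> ?V" using inV[OF that, of x] by simp
    moreover have "y \<notin> X \<union> Y" using bwd[OF that, of x] x disj by blast
    ultimately show "y \<in> W \<union> Z" by blast
  qed
  have cY: "card (p ` Y) = card Y" if "p \<in> ?Q" for p using card_image[OF inj[OF that]] .
  have "?R ({} \<union> Y) * fact (card Z - card Y) \<le> ?R {} * fact (card Z)"
    by (rule card_restrict_extend[OF Q fin(3) fin(2)]) (auto simp: inj dest: Y)
  also have "?R {} \<le> 1"
    by (rule order.trans[OF card_mono[of "{\<lambda>_. undefined}"]]) auto
  finally have 1: "?R Y * fact r \<le> fact (card Y + r)" by (simp add: cZ)
  \<comment> \<open>\<open>Y\<close> has taken |Y| of the |Y|+r places in \<open>Z\<close>, which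
    leaves |X|+r places for \<open>X\<close>.\<close>
  have "?R (Y \<union> X) * fact (card X + r - card X) \<le> ?R Y * fact (card X + r)"
  proof (rule card_restrict_extend[OF Q, where D = "X \<union> Z"])
    show "card (X \<union> Z - p ` Y) \<le> card X + r" if "p \<in> ?Q" for p
      using Y[OF that] fin disj cY[OF that] cZ
      by (subst card_Diff_subset) (auto simp: card_Un_disjoint)
    show "p ` X \<subseteq> X \<union> Z" if "p \<in> ?Q" for p
      using fwd[OF that] by blast
  qed (use fin disj in \<open>auto simp: inj\<close>)
  then have 2: "?R (Y \<union> X) * fact r \<le> ?R Y * fact (card X + r)" by simp
  have "?R ((Y \<union> X) \<union> W) * fact (card W + r - card W) \<le> ?R (Y \<union> X) * fact (card W + r)"
  proof (rule card_restrict_extend[OF Q, where D = "W \<union> Z"])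
    show "card (W \<union> Z - p ` (Y \<union> X)) \<le> card W + r" if "p \<in> ?Q" for p
    proof -
      \<comment> \<open>Places in \<open>Z\<close> taken by \<open>X\<close> are not deducted. For r
        = 0 this loses nothing, since \<open>Y\<close> then fills \<open>Z\<close>.\<close>
      have "card (W \<union> Z - p ` (Y \<union> X)) \<le> card (W \<union> Z - p ` Y)"
        using fin by (intro card_mono) auto
      also have "\<dots> = card W + r"
        using Y[OF that] fin disj cY[OF that] cZ
        by (subst card_Diff_subset) (auto simp: card_Un_disjoint Int_commute)
      finally show ?thesis .
    qed
  qed (use fin disj W in \<open>auto simp: inj\<close>)
  then have 3: "?R (Y \<union> X \<union> W) * fact r \<le> ?R (Y \<union> X) * fact (card W + r)" by simp
  have "?R ((Y \<union> X \<union> W) \<union> Z) * fact (card Z - card Z) \<le> ?R (Y \<union> X \<union> W) * fact (card Z)"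
  proof (rule card_restrict_extend[OF Q finV fin(3)])
    show "p ` Z \<subseteq> ?V" if "p \<in> ?Q" for p using inV[OF that] by blast
    show "card (?V - p ` (Y \<union> X \<union> W)) \<le> card Z" if "p \<in> ?Q" for p
    proof -
      \<comment> \<open>The places still free are values at points of \<open>Z\<close>, hence at
        most |Z| many.\<close>
      have "?V - p ` (Y \<union> X \<union> W) \<subseteq> p ` Z"
        using permutes_image[OF per[OF that]] by auto
      then show ?thesis
        using surj_card_le fin(3) by blast
    qed
  qed (use fin disj in \<open>auto simp: inj\<close>)
  also have "Y \<union> X \<union> W \<union> Z = ?V" by auto
  also have "?R ?V = card ?Q"
    by (rule card_restrict_permutes) (rule per)
  finally have 4: "card ?Q \<le> ?R (Y \<union> X \<union> W) * fact (card Y + r)"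
    by (simp only: cZ diff_self_eq_0 fact_0 mult_1_right)
  let ?f = "fact :: nat \<Rightarrow> nat"
  have "card ?Q * ?f r ^ 3 \<le> (?R (Y \<union> X \<union> W) * ?f r) * (?f r ^ 2 * ?f (card Y + r))"
    using mult_right_mono[OF 4, of "?f r ^ 3"] by (simp add: power2_eq_square power3_eq_cube ac_simps)
  also have "\<dots> \<le> (?R (Y \<union> X) * ?f r) * (?f (card W + r) * ?f r * ?f (card Y + r))"
    using mult_right_mono[OF 3, of "?f r ^ 2 * ?f (card Y + r)"] by (simp add: power2_eq_square ac_simps)
  also have "\<dots> \<le> (?R Y * ?f r) * (?f (card X + r) * ?f (card W + r) * ?f (card Y + r))"
    using mult_right_mono[OF 2, of "?f (card W + r) * ?f r * ?f (card Y + r)"] by (simp add: ac_simps)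
  also have "\<dots> \<le> ?f (card Y + r) * (?f (card X + r) * ?f (card W + r) * ?f (card Y + r))"
    using mult_right_mono[OF 1, of "?f (card X + r) * ?f (card W + r) * ?f (card Y + r)"] by simp
  finally show ?thesis by (simp add: power2_eq_square ac_simps)
qed

section \<open>Counting pairs of sets with given intersection and differences\<close>

definition pairs_of_type :: "'a set \<Rightarrow> nat \<Rightarrow> nat \<Rightarrow> nat \<Rightarrow> ('a set \<times> 'a set) set" where
  "pairs_of_type V s t u = {(A, B). A \<subseteq> V \<and> B \<subseteq> V \<and>
     card (A \<inter> B) = s \<and> card (A - B) = t \<and> card (B - A) = u}"

text \<open>The blocks \<open>A \<inter> B\<close>, \<open>A - B\<close> and \<open>B - A\<close>
  determine the pair; choosing them in turn gives a multinomial coefficient, with \<open>w\<close>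
  the size of the complement of \<open>A \<union> B\<close>.\<close>

lemma card_pairs_of_type_le:
  assumes "finite V" "card V = s + t + u + w"
  shows "card (pairs_of_type V s t u) * (fact s * fact t * fact u * fact w) \<le> (fact (card V) :: nat)"
proof -
  let ?sub = "\<lambda>U k. {X. X \<subseteq> U \<and> card X = k}"
  let ?S = "SIGMA X:?sub V s. SIGMA Y:?sub (V - X) t. ?sub (V - X - Y) u"
  have fs: "finite (?sub U k)" if "U \<subseteq> V" for U k
    using assms(1) that by (auto intro: finite_subset[of _ "Pow V"])
  have fin: "finite ?S"
    by (intro finite_SigmaI fs) auto
  have "card (pairs_of_type V s t u) \<le> card ?S"
  proof (rule card_inj_on_le[OF _ _ fin])
    show "inj_on (\<lambda>(A, B). (A \<inter> B, A - B, B - A)) (pairs_of_type V s t u)"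
      by (rule inj_onI) auto
    show "(\<lambda>(A, B). (A \<inter> B, A - B, B - A)) ` pairs_of_type V s t u \<subseteq> ?S"
      by (auto simp: pairs_of_type_def)
  qed
  also have "card ?S = (\<Sum>X\<in>?sub V s. \<Sum>Y\<in>?sub (V - X) t. card (?sub (V - X - Y) u))"
    by (subst card_SigmaI; (intro ballI fs finite_SigmaI)?; auto intro!: sum.cong card_SigmaI fs finite_SigmaI)
  also have "\<dots> = (\<Sum>X\<in>?sub V s. \<Sum>Y\<in>?sub (V - X) t. (u + w choose u))"
    using assms
    by (intro sum.cong refl) (auto simp: n_subsets card_Diff_subset finite_subset add.assoc)
  also have "\<dots> = (\<Sum>X\<in>?sub V s. (t + u + w choose t) * (u + w choose u))"
    using assms
    by (intro sum.cong refl) (auto simp: n_subsets card_Diff_subset finite_subset add.assoc)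
  also have "\<dots> = (s + t + u + w choose s) * (t + u + w choose t) * (u + w choose u)"
    using assms by (simp add: n_subsets)
  finally have "card (pairs_of_type V s t u) * (fact s * fact t * fact u * fact w) \<le>
     (s + t + u + w choose s) * (t + u + w choose t) * (u + w choose u) * (fact s * fact t * fact u * fact w)"
    by (rule mult_right_mono) simp
  also have "\<dots> = fact (card V)"
  proof -
    have "fact (t + u + w) = fact t * (fact u * fact w * (u + w choose u)) * (t + u + w choose t)"
      using binomial_fact_lemma[of t "t + u + w"] binomial_fact_lemma[of u "u + w"]
      by (simp add: add.assoc)
    moreover have "fact (card V) = fact s * fact (t + u + w) * (s + t + u + w choose s)"
      using binomial_fact_lemma[of s "s + t + u + w"] assms(2) by (simp add: add.assoc)
    ultimately show ?thesis by (simp only: mult.assoc mult.commute mult.left_commute)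
  qed
  finally show ?thesis .
qed

subsection \<open>Binomial estimates\<close>

text \<open>A weak Stirling bound: the induction step costs a factor (1 + 1/r)^r \<le> e \<le>
  3.\<close>

lemma power_self_le_fact: "(real r) ^ r \<le> 3 ^ r * fact r"
proof (induction r)
  case (Suc r)
  show ?case
  proof (cases "r = 0")
    case False
    have "(1 + 1 / real r) ^ r \<le> exp 1"
      using False by (intro exp_ge_one_plus_x_over_n_power_n) auto
    also have "\<dots> \<le> 3" by (rule exp_le)
    finally have *: "(1 + 1 / real r) ^ r \<le> 3" .
    have "real (Suc r) ^ r = (1 + 1 / real r) ^ r * real r ^ r"
      using False by (simp add: power_mult_distrib[symmetric] field_simps)
    also have "\<dots> \<le> 3 * (3 ^ r * fact r)"
      using * Suc.IH by (intro mult_mono) auto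
    finally have "real (Suc r) * real (Suc r) ^ r \<le> real (Suc r) * (3 * (3 ^ r * fact r))"
      by (rule mult_left_mono) simp
    then show ?thesis by (simp add: algebra_simps)
  qed simp
qed simp

lemma binomial_le_power:
  assumes "0 < r"
  shows "real (n choose r) \<le> (3 * real n / real r) ^ r"
proof -
  have "real (n choose r) * real r ^ r \<le> real (n choose r) * (3 ^ r * fact r)"
    by (intro mult_left_mono power_self_le_fact) simp
  also have "\<dots> = 3 ^ r * real ((n choose r) * fact r)" by simp
  also have "\<dots> \<le> 3 ^ r * real (n ^ r)"
    by (intro mult_left_mono of_nat_mono binomial_fact_pow) simp
  finally show ?thesis
    using assms by (simp add: power_mult_distrib power_divide field_simps)
qed

text \<open>
  The constant 72 determines \<open>\<gamma> = 1/72\<close>. It is of the form \<open>8 * c\<close> with \<open>2 ^ (c - 1) \<ge> 3 * (8 * c)\<close>; here \<open>c = 9\<close>.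
\<close>

lemma binomial_power_le_binomial:
  assumes "0 < r" "72 * r \<le> k" "2 * k \<le> n"
  shows "(n choose r) ^ 8 \<le> n choose k"
proof -
  define y where "y = real n / (72 * real r)"
  have y2: "y \<ge> 2" using assms by (simp add: y_def field_simps)
  \<comment> \<open>Here 3n/r = 216y. As 216 \<le> 2^8, the factor 216 is absorbed by y^8, so that
    216y \<le> y^9 and the total exponent becomes 8 * 9 * r = 72r.\<close>
  have "(2::real) ^ 8 \<le> y ^ 8" using y2 by (intro power_mono) auto
  then have y8: "216 \<le> y ^ 8" by simp
  have "real (n choose r) ^ 8 \<le> ((3 * real n / real r) ^ r) ^ 8"
    using binomial_le_power[OF assms(1)] by (intro power_mono) auto
  also have "\<dots> = ((216 * y) ^ 8) ^ r"
    using assms(1) by (simp add: y_def power_mult[symmetric] mult.commute)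
  also have "\<dots> \<le> ((y ^ 8 * y) ^ 8) ^ r"
    using y2 y8 by (intro power_mono mult_right_mono) auto
  also have "\<dots> = y ^ (72 * r)"
    by (simp add: power_mult[symmetric] power_Suc2[symmetric])
  also have "\<dots> = (real n / real (72 * r)) ^ (72 * r)" by (simp add: y_def)
  also have "\<dots> \<le> real (n choose (72 * r))"
    using assms by (intro binomial_ge_n_over_k_pow_k) simp
  also have "\<dots> \<le> real (n choose k)"
    using assms by (intro of_nat_mono binomial_mono) auto
  finally show ?thesis by (metis of_nat_le_iff of_nat_power)
qed

section \<open>Probability that one permutation is trapped, for a single pair and summed over a
  type\<close>

text \<open>Dividing \<open>card_trapping_le\<close> by n! gives C(k+r, r) / C(n, k) with k = |A|.
  The bound serves for the \<open>m\<close> factors that do not pay for the choice of the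
  pair.\<close>

lemma trapping_frequency_le:
  assumes "finite V" "A \<subseteq> V" "B \<subseteq> V" "card B = card A + r"
  shows "real (card (trapping V A B)) / fact (card V) \<le> real (card V choose r) / real (card V choose card A)"
proof -
  let ?n = "card V" and ?k = "card A" and ?N = "card (trapping V A B)"
  let ?f = "fact :: nat \<Rightarrow> nat"
  have le: "?k + r \<le> ?n" using assms by (metis card_mono)
  have "?N * (?n choose ?k) * (?f r * ?f ?k) = ?N * ?f r * (?f ?k * (?n choose ?k))" by simp
  also have "\<dots> \<le> (?f (?k + r) * ?f (?n - ?k)) * (?f ?k * (?n choose ?k))"
    by (rule mult_right_mono[OF card_trapping_le[OF assms]]) simp
  also have "\<dots> = ?f (?k + r) * ?f ?n"
    using binomial_fact_lemma[of ?k ?n] le by (simp add: mult.assoc mult.commute mult.left_commute)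
  also have "\<dots> = ((?k + r choose r) * ?f ?n) * (?f r * ?f ?k)"
    using binomial_fact_lemma[of r "?k + r"] by (simp add: mult.assoc mult.commute mult.left_commute)
  finally have "?N * (?n choose ?k) \<le> (?k + r choose r) * ?f ?n" by simp
  also have "\<dots> \<le> (?n choose r) * ?f ?n"
    using le by (intro mult_right_mono binomial_right_mono) auto
  finally have "real (?N * (?n choose ?k)) \<le> real ((?n choose r) * ?f ?n)"
    by (rule of_nat_mono)
  moreover have "0 < ?n choose ?k" using le by simp
  ultimately show ?thesis by (simp add: field_simps)
qed

text \<open>The factor that pays for the choice of the pair. The multinomial count of pairs times
  the sharp bound on trapped permutations collapses to C(t+r, r) C(s+r, r) C(w+r, r), which is 1 for
  r = 0.\<close>

lemma sum_trapping_frequency_type_le: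
  assumes "finite V"
  shows "(\<Sum>(A, B)\<in>pairs_of_type V s t (t + r). real (card (trapping V A B)) / fact (card V))
      \<le> real (card V choose r) ^ 3"
proof (cases "pairs_of_type V s t (t + r) = {}")
  case False
  let ?n = "card V" and ?P = "pairs_of_type V s t (t + r)"
  let ?f = "fact :: nat \<Rightarrow> real"
  \<comment> \<open>One sample pair shows that |V| = s + t + (t + r) + w for some
    \<open>w\<close>.\<close>
  obtain A\<^sub>0 B\<^sub>0 where "(A\<^sub>0, B\<^sub>0) \<in> ?P" using False by auto
  then have AB0: "A\<^sub>0 \<subseteq> V" "B\<^sub>0 \<subseteq> V" "card (A\<^sub>0 \<inter> B\<^sub>0) = s" "card (A\<^sub>0 - B\<^sub>0) = t" "card (B\<^sub>0 - A\<^sub>0) = t + r"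
    by (auto simp: pairs_of_type_def)
  have fin0: "finite A\<^sub>0" "finite B\<^sub>0" using AB0 assms finite_subset by auto
  have split0: "V = ((A\<^sub>0 \<inter> B\<^sub>0) \<union> (A\<^sub>0 - B\<^sub>0) \<union> (B\<^sub>0 - A\<^sub>0)) \<union> (V - (A\<^sub>0 \<union> B\<^sub>0))" using AB0 by auto
  have "?n = card ((A\<^sub>0 \<inter> B\<^sub>0) \<union> (A\<^sub>0 - B\<^sub>0) \<union> (B\<^sub>0 - A\<^sub>0)) + card (V - (A\<^sub>0 \<union> B\<^sub>0))"
    by (subst split0, rule card_Un_disjoint) (use fin0 assms in auto)
  also have "card ((A\<^sub>0 \<inter> B\<^sub>0) \<union> (A\<^sub>0 - B\<^sub>0) \<union> (B\<^sub>0 - A\<^sub>0)) = card ((A\<^sub>0 \<inter> B\<^sub>0) \<union> (A\<^sub>0 - B\<^sub>0)) + card (B\<^sub>0 - A\<^sub>0)"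
    by (rule card_Un_disjoint) (use fin0 in auto)
  also have "card ((A\<^sub>0 \<inter> B\<^sub>0) \<union> (A\<^sub>0 - B\<^sub>0)) = card (A\<^sub>0 \<inter> B\<^sub>0) + card (A\<^sub>0 - B\<^sub>0)"
    by (rule card_Un_disjoint) (use fin0 in auto)
  finally obtain w where w: "?n = s + t + (t + r) + w" using AB0 by auto
  define N0 where "N0 = ?f (t + r) ^ 2 * ?f (s + r) * ?f (w + r) / ?f r ^ 3"
  have N0: "real (card (trapping V A B)) \<le> N0" if "(A, B) \<in> ?P" for A B
  proof -
    let ?X = "A \<inter> B" and ?Y = "A - B" and ?Z = "B - A" and ?W = "V - (A \<union> B)"
    have AB: "A \<subseteq> V" "B \<subseteq> V" "card ?X = s" "card ?Y = t" "card ?Z = t + r"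
      using that by (auto simp: pairs_of_type_def)
    have fin: "finite A" "finite B" using AB assms finite_subset by auto
    have eqs: "?X \<union> ?Y = A" "?X \<union> ?Z = B" "A \<union> ?Z \<union> ?W = V" using AB by auto
    have "card (A \<union> B) = card A + card ?Z"
      using card_Un_disjoint[of A ?Z] fin by simp
    also have "card A = card ?X + card ?Y"
      using card_Un_disjoint[of ?X ?Y] fin eqs(1) by force
    finally have W: "card ?W = w"
      using w AB fin assms by (subst card_Diff_subset) auto
    have "card (trapping (?X \<union> ?Y \<union> ?Z \<union> ?W) (?X \<union> ?Y) (?X \<union> ?Z)) * fact r ^ 3
        \<le> (fact (card ?Y + r) ^ 2 * fact (card ?X + r) * fact (card ?W + r) :: nat)"
      by (rule card_trapping_le_type) (use fin assms AB in auto)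
    then have "card (trapping V A B) * fact r ^ 3 \<le> (fact (t + r) ^ 2 * fact (s + r) * fact (w + r) :: nat)"
      unfolding eqs AB(3,4) W .
    then have "real (card (trapping V A B) * fact r ^ 3) \<le> real (fact (t + r) ^ 2 * fact (s + r) * fact (w + r))"
      by (rule of_nat_mono)
    then show ?thesis by (simp add: N0_def field_simps)
  qed
  have "card ?P * (fact s * fact t * fact (t + r) * fact w) \<le> (fact ?n :: nat)"
    using card_pairs_of_type_le[OF assms w] .
  then have "real (card ?P * (fact s * fact t * fact (t + r) * fact w)) \<le> real (fact ?n)"
    by (rule of_nat_mono)
  then have P: "real (card ?P) / ?f ?n \<le> 1 / (?f s * ?f t * ?f (t + r) * ?f w)"
    by (simp add: field_simps)
  have "(\<Sum>(A, B)\<in>?P. real (card (trapping V A B)) / ?f ?n) \<le> (\<Sum>(A, B)\<in>?P. N0 / ?f ?n)"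
    by (intro sum_mono) (auto intro!: divide_right_mono N0)
  also have "\<dots> = N0 * (real (card ?P) / ?f ?n)" by simp
  also have "\<dots> \<le> N0 * (1 / (?f s * ?f t * ?f (t + r) * ?f w))"
    using P by (intro mult_left_mono) (auto simp: N0_def)
  also have "\<dots> = real (t + r choose r) * real (s + r choose r) * real (w + r choose r)"
    by (simp add: N0_def binomial_fact power2_eq_square power3_eq_cube field_simps)
  also have "\<dots> \<le> real (?n choose r) * real (?n choose r) * real (?n choose r)"
    using w by (intro mult_mono of_nat_mono binomial_right_mono) auto
  finally show ?thesis by (simp add: power3_eq_cube)
qed simp

subsection \<open>The union bound\<close>

text \<open>The last condition is |B| < (1 + 1/72)|A| in integers. Requiring |A| \<le> |B| keeps the
  truncated difference a true one; it holds for neighbourhoods because permutations are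
  injective.\<close>

definition compressed_pairs :: "'a set \<Rightarrow> ('a set \<times> 'a set) set" where
  "compressed_pairs V = {(A, B). A \<subseteq> V \<and> B \<subseteq> V \<and> A \<noteq> {} \<and> 2 * card A \<le> card V \<and>
     card A \<le> card B \<and> 72 * (card B - card A) < card A}"

text \<open>A triple \<open>(s, t, r)\<close> stands for \<open>|A \<inter> B|\<close>, \<open>|A - B|\<close> and \<open>|B| - |A|\<close>.\<close>

definition compressed_types :: "nat \<Rightarrow> (nat \<times> nat \<times> nat) set" where
  "compressed_types n = {(s, t, r). 1 \<le> s + t \<and> 2 * (s + t) \<le> n \<and> 72 * r < s + t}"

lemma compressed_types_subset: "compressed_types n \<subseteq> {..n} \<times> {..n} \<times> {..n}"
  by (auto simp: compressed_types_def)

lemma finite_compressed_types: "finite (compressed_types n)"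
  by (rule finite_subset[OF compressed_types_subset]) simp

lemma finite_compressed_pairs: "finite V \<Longrightarrow> finite (compressed_pairs V)"
  by (rule finite_subset[of _ "Pow V \<times> Pow V"]) (auto simp: compressed_pairs_def)

lemma not_spreader_imp_trapping:
  assumes perm: "\<And>j. j \<in> {1..d div 2} \<Longrightarrow> \<pi> j permutes {1..n}" and "d \<ge> 2"
    and "\<not> spreader (1 / 72) (shape (perm_graph n d \<pi>))"
  obtains A B where "(A, B) \<in> compressed_pairs {1..n}"
    "\<And>j. j \<in> {1..d div 2} \<Longrightarrow> \<pi> j \<in> trapping {1..n} A B"
proof -
  let ?G = "shape (perm_graph n d \<pi>)"
  let ?V = "{1..n}"
  have verts: "verts ?G = ?V" by (simp add: perm_graph_def)
  obtain A where A: "A \<subseteq> ?V" "real (card A) \<le> real n / 2"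
    "real (card (nbhd ?G A)) < (1 + 1 / 72) * real (card A)"
    using assms(3) unfolding spreader_def verts by (auto simp del: atLeastAtMost_iff simp: not_le)
  define B where "B = nbhd ?G A"
  have BV: "B \<subseteq> ?V" unfolding B_def nbhd_def verts by blast
  have step: "act \<pi> l v \<in> B" if "v \<in> A" "l \<in> letters d" for v l
  proof -
    have "(v, l) \<in> arcs ?G" using that A(1) by (auto simp: perm_graph_def)
    moreover have "tail ?G (v, l) = v" "head ?G (v, l) = act \<pi> l v" by (simp_all add: perm_graph_def)
    ultimately have dom: "v \<rightarrow>\<^bsub>?G\<^esub> act \<pi> l v"
      unfolding arcs_ends_conv by (intro image_eqI[of _ _ "(v, l)"]) simp_all
    have "wf_digraph ?G"
      using bidirected_perm_graph[OF perm] by (rule bidirected_digraph.axioms(1))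
    then have "act \<pi> l v \<in> verts ?G" using dom by (rule wf_digraph.adj_in_verts(2))
    then show ?thesis using that dom unfolding B_def nbhd_def by blast
  qed
  have trap: "\<pi> j \<in> trapping ?V A B" if j: "j \<in> {1..d div 2}" for j
  proof -
    have "Fwd j \<in> letters d" "Bwd j \<in> letters d" using j by (auto simp: letters_def)
    then have "\<pi> j ` A \<subseteq> B" "inv_into UNIV (\<pi> j) ` A \<subseteq> B"
      using step[of _ "Fwd j"] step[of _ "Bwd j"] by auto
    then show ?thesis using perm[OF j] by (simp add: trapping_def)
  qed
  have "1 \<in> {1..d div 2}" using \<open>d \<ge> 2\<close> by simp
  note trap1 = trap[OF this] and perm1 = perm[OF this]
  \<comment> \<open>A single permutation already embeds \<open>A\<close> into
    \<open>B\<close>.\<close>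
  from trap1 have "\<pi> 1 ` A \<subseteq> B" by (simp add: trapping_def)
  moreover from perm1 have "inj_on (\<pi> 1) A" by (rule permutes_inj_on)
  moreover have "finite B" using BV finite_subset by blast
  ultimately have "card A \<le> card B" using card_inj_on_le by blast
  moreover have "real (card B) < (1 + 1 / 72) * real (card A)" using A(3) unfolding B_def .
  then have "real (72 * card B) < real (73 * card A)" by simp
  then have "72 * card B < 73 * card A" by (simp only: of_nat_less_iff)
  moreover have "real (2 * card A) \<le> real n" using A(2) by simp
  then have "2 * card A \<le> n" by (simp only: of_nat_le_iff)
  \<comment> \<open>An empty \<open>A\<close> would make a cardinality negative.\<close>
  moreover have "A \<noteq> {}" using A(3) by auto
  ultimately have "(A, B) \<in> compressed_pairs ?V"
    using A(1) BV unfolding compressed_pairs_def by simp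
  with trap show ?thesis using that by blast
qed

lemma prob_trapping:
  assumes "finite V" "finite J"
  shows "measure_pmf.prob (Pi_pmf J dflt (\<lambda>_. pmf_of_set {p. p permutes V})) {\<pi>. \<forall>j\<in>J. \<pi> j \<in> trapping V A B}
     = (real (card (trapping V A B)) / fact (card V)) ^ card J"
proof -
  let ?S = "{p. p permutes V}"
  have "id \<in> ?S" by (simp add: permutes_id)
  then have S: "finite ?S" "?S \<noteq> {}" using assms(1) finite_permutations by blast+
  have "?S \<inter> trapping V A B = trapping V A B" by (auto simp: trapping_def)
  then have "measure_pmf.prob (pmf_of_set ?S) (trapping V A B) = real (card (trapping V A B)) / fact (card V)"
    using S assms(1) by (simp add: measure_pmf_of_set card_permutations)
  moreover have "{\<pi>. \<forall>j\<in>J. \<pi> j \<in> trapping V A B} = Pi J (\<lambda>_. trapping V A B)" by auto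
  ultimately show ?thesis by (simp add: measure_Pi_pmf_Pi[OF assms(2)])
qed

lemma prob_not_spreader_le:
  assumes "d \<ge> 2"
  shows "1 - measure_pmf.prob (random_graph n d) {G. spreader (1 / 72) (shape G)}
    \<le> (\<Sum>(A, B)\<in>compressed_pairs {1..n}. (real (card (trapping {1..n} A B)) / fact n) ^ (d div 2))"
proof -
  let ?V = "{1..n}" and ?J = "{1..d div 2}"
  let ?P = "Pi_pmf ?J id (\<lambda>_. pmf_of_set {p. p permutes ?V})"
  let ?bad = "{\<pi>. \<not> spreader (1 / 72) (shape (perm_graph n d \<pi>))}"
  let ?trap = "\<lambda>(A, B). {\<pi>. \<forall>j\<in>?J. \<pi> j \<in> trapping ?V A B}"
  have ne: "{p. p permutes ?V} \<noteq> {}" using permutes_id by blast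
  have perm: "\<pi> j permutes ?V" if "\<pi> \<in> set_pmf ?P" "j \<in> ?J" for \<pi> j
  proof -
    have "\<pi> \<in> PiE_dflt ?J id (set_pmf \<circ> (\<lambda>_. pmf_of_set {p. p permutes ?V}))"
      using that(1) by (simp add: set_Pi_pmf)
    then have "\<pi> j \<in> set_pmf (pmf_of_set {p. p permutes ?V})" using that(2) by (auto simp: PiE_dflt_def)
    then show ?thesis using ne finite_permutations[of ?V] by simp
  qed
  have "1 - measure_pmf.prob (random_graph n d) {G. spreader (1 / 72) (shape G)}
      = measure_pmf.prob ?P ?bad"
  proof -
    have "measure_pmf.prob (random_graph n d) {G. spreader (1 / 72) (shape G)} = measure_pmf.prob ?P (- ?bad)"
      by (simp add: random_graph_def vimage_def Compl_eq)
    moreover have "measure_pmf.prob ?P (- ?bad) = 1 - measure_pmf.prob ?P ?bad"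
      using measure_pmf.prob_compl[of ?bad ?P] by (simp add: Compl_eq_Diff_UNIV)
    ultimately show ?thesis by simp
  qed
  also have "\<dots> \<le> measure_pmf.prob ?P (\<Union>x\<in>compressed_pairs ?V. ?trap x)"
  proof (rule measure_pmf.finite_measure_mono_AE)
    \<comment> \<open>The coordinates of \<open>\<pi>\<close> are known to be permutations only on
      the support, hence an almost-everywhere inclusion.\<close>
    show "AE \<pi> in measure_pmf ?P. \<pi> \<in> ?bad \<longrightarrow> \<pi> \<in> (\<Union>x\<in>compressed_pairs ?V. ?trap x)"
      unfolding AE_measure_pmf_iff
    proof (intro ballI impI)
      fix \<pi> assume \<pi>: "\<pi> \<in> set_pmf ?P" "\<pi> \<in> ?bad"
      then obtain A B where "(A, B) \<in> compressed_pairs ?V" "\<And>j. j \<in> ?J \<Longrightarrow> \<pi> j \<in> trapping ?V A B"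
        using not_spreader_imp_trapping[of d \<pi> n] perm assms by blast
      then show "\<pi> \<in> (\<Union>x\<in>compressed_pairs ?V. ?trap x)" by blast
    qed
  qed simp
  also have "\<dots> \<le> (\<Sum>x\<in>compressed_pairs ?V. measure_pmf.prob ?P (?trap x))"
    by (rule measure_pmf.finite_measure_subadditive_finite) (simp_all add: finite_compressed_pairs)
  also have "\<dots> = (\<Sum>(A, B)\<in>compressed_pairs ?V. (real (card (trapping ?V A B)) / fact n) ^ (d div 2))"
    by (rule sum.cong) (auto simp: prob_trapping)
  finally show ?thesis .
qed

text \<open>Group the pairs by type. Within a type, \<open>m\<close> of the \<open>Suc m\<close>
  factors have a common bound and come out of the sum; the remaining factor is summed by
  \<open>sum_trapping_frequency_type_le\<close>.\<close>

lemma sum_compressed_pairs_le: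
  assumes "finite V"
  shows "(\<Sum>(A, B)\<in>compressed_pairs V. (real (card (trapping V A B)) / fact (card V)) ^ Suc m)
    \<le> (\<Sum>(s, t, r)\<in>compressed_types (card V).
          real (card V choose r) ^ 3 * (real (card V choose r) / real (card V choose (s + t))) ^ m)"
proof -
  let ?n = "card V" and ?C = "compressed_pairs V" and ?T = "compressed_types (card V)"
  let ?fr = "\<lambda>(A, B). real (card (trapping V A B)) / fact ?n"
  let ?ty = "\<lambda>(A, B). (card (A \<inter> B), card (A - B), card B - card A)"
  have card_A: "card A = card (A \<inter> B) + card (A - B)"
    and card_BA: "card A \<le> card B \<Longrightarrow> card (B - A) = card (A - B) + (card B - card A)"
    if "A \<subseteq> V" "B \<subseteq> V" for A B
  proof -
    have fin: "finite A" "finite B" using that assms finite_subset by auto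
    have *: "card A' = card (A' \<inter> B') + card (A' - B')" if "finite A'" for A' B' :: "'a set"
      using card_Un_disjoint[of "A' \<inter> B'" "A' - B'"] that by (simp add: Int_Diff_Un Int_Diff_disjoint)
    show "card A = card (A \<inter> B) + card (A - B)" using *[OF fin(1)] .
    then show "card A \<le> card B \<Longrightarrow> card (B - A) = card (A - B) + (card B - card A)"
      using *[OF fin(2), of A] by (simp add: Int_commute)
  qed
  have "?ty ` ?C \<subseteq> ?T"
  proof
    fix x assume "x \<in> ?ty ` ?C"
    then obtain A B where AB: "(A, B) \<in> ?C" and x: "x = (card (A \<inter> B), card (A - B), card B - card A)"
      by auto
    have sub: "A \<subseteq> V" "B \<subseteq> V" using AB by (auto simp: compressed_pairs_def)
    then have "card A \<ge> 1" using AB assms finite_subset[OF sub(1)]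
      by (auto simp: compressed_pairs_def Suc_le_eq card_gt_0_iff)
    then show "x \<in> ?T"
      using AB card_A[OF sub] by (auto simp: x compressed_pairs_def compressed_types_def)
  qed
  then have "(\<Sum>x\<in>?C. ?fr x ^ Suc m) = (\<Sum>y\<in>?T. \<Sum>x\<in>{x \<in> ?C. ?ty x = y}. ?fr x ^ Suc m)"
    using assms by (intro sum.group[symmetric] finite_compressed_types finite_compressed_pairs)
  also have "\<dots> \<le> (\<Sum>(s, t, r)\<in>?T. real (?n choose r) ^ 3 * (real (?n choose r) / real (?n choose (s + t))) ^ m)"
  proof (rule sum_mono)
    fix y assume "y \<in> ?T"
    obtain s t r where y: "y = (s, t, r)" by (cases y)
    let ?q = "real (?n choose r) / real (?n choose (s + t))"
    have fr0: "0 \<le> ?fr x" for x by (cases x) simp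
    have finP: "finite (pairs_of_type V s t (t + r))"
      by (rule finite_subset[of _ "Pow V \<times> Pow V"]) (use assms in \<open>auto simp: pairs_of_type_def\<close>)
    have fr_le: "?fr (A, B) \<le> ?q" and in_type: "(A, B) \<in> pairs_of_type V s t (t + r)"
      if "(A, B) \<in> ?C" "?ty (A, B) = y" for A B
    proof -
      have sub: "A \<subseteq> V" "B \<subseteq> V" and le: "card A \<le> card B" using that(1) by (auto simp: compressed_pairs_def)
      have "card A = s + t" "card B = card A + r" using that(2) card_A[OF sub] le by (auto simp: y)
      then show "?fr (A, B) \<le> ?q" using trapping_frequency_le[OF assms sub] by simp
      show "(A, B) \<in> pairs_of_type V s t (t + r)"
        using that(2) sub card_BA[OF sub le] by (auto simp: y pairs_of_type_def)
    qed
    have "(\<Sum>x\<in>{x \<in> ?C. ?ty x = y}. ?fr x ^ Suc m) \<le> (\<Sum>x\<in>{x \<in> ?C. ?ty x = y}. ?fr x * ?q ^ m)"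
    proof (rule sum_mono)
      fix x assume "x \<in> {x \<in> ?C. ?ty x = y}"
      then have "?fr x \<le> ?q" using fr_le by (cases x) blast
      then show "?fr x ^ Suc m \<le> ?fr x * ?q ^ m"
        unfolding power_Suc using fr0 by (intro mult_left_mono power_mono)
    qed
    also have "\<dots> \<le> (\<Sum>x\<in>pairs_of_type V s t (t + r). ?fr x * ?q ^ m)"
    proof (rule sum_mono2[OF finP])
      show "{x \<in> ?C. ?ty x = y} \<subseteq> pairs_of_type V s t (t + r)"
      proof
        fix x assume "x \<in> {x \<in> ?C. ?ty x = y}"
        then show "x \<in> pairs_of_type V s t (t + r)" using in_type by (cases x) blast
      qed
      show "0 \<le> ?fr x * ?q ^ m" for x using fr0 by (intro mult_nonneg_nonneg) auto
    qed
    also have "\<dots> = (\<Sum>x\<in>pairs_of_type V s t (t + r). ?fr x) * ?q ^ m"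
      by (rule sum_distrib_right[symmetric])
    also have "\<dots> \<le> real (?n choose r) ^ 3 * ?q ^ m"
      using sum_trapping_frequency_type_le[OF assms] by (intro mult_right_mono) auto
    finally show "(\<Sum>x\<in>{x \<in> ?C. ?ty x = y}. ?fr x ^ Suc m) \<le>
        (case y of (s, t, r) \<Rightarrow> real (?n choose r) ^ 3 * (real (?n choose r) / real (?n choose (s + t))) ^ m)"
      by (simp add: y)
  qed
  finally show ?thesis by (simp add: case_prod_beta)
qed

section \<open>Summation over the types\<close>

text \<open>Only r = 0 with |A| \<le> 3 contributes at order n^(-m), and there are boundedly many
  such types. All other terms are O(n^(-4m)), small enough for a sum over O(n^3) types.\<close>

lemma compressed_type_term_le:
  assumes "(s, t, r) \<in> compressed_types n" "m \<ge> 1"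
  shows "real (n choose r) ^ 3 * (real (n choose r) / real (n choose (s + t))) ^ m
    \<le> of_bool (r = 0 \<and> s + t \<le> 3) * (1 / real n) ^ m + (256 / real n ^ 4) ^ m"
proof -
  let ?c = "real (n choose r)" and ?K = "real (n choose (s + t))"
  have k: "1 \<le> s + t" "2 * (s + t) \<le> n" "72 * r < s + t"
    using assms(1) by (auto simp: compressed_types_def)
  then have n: "real n \<ge> 1" by simp
  have nonneg: "0 \<le> of_bool (r = 0 \<and> s + t \<le> 3) * (1 / real n) ^ m" "0 \<le> (256 / real n ^ 4) ^ m"
    by simp_all
  consider (small) "r = 0" "s + t \<le> 3" | (large) "r = 0" "s + t \<ge> 4" | (slack) "r \<ge> 1" by linarith
  then show ?thesis
  proof cases
    case small
    have "n choose 1 \<le> n choose (s + t)" using k by (intro binomial_mono) auto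
    then have "real n \<le> ?K" by simp
    then have "(1 / ?K) ^ m \<le> (1 / real n) ^ m" using n by (intro power_mono frac_le) auto
    with small have "?c ^ 3 * (?c / ?K) ^ m \<le> of_bool (r = 0 \<and> s + t \<le> 3) * (1 / real n) ^ m"
      by simp
    then show ?thesis using nonneg(2) by linarith
  next
    case large
    \<comment> \<open>Binomial coefficients increase up to n/2, so C(n, 4) is the least one here;
      256 = 4^4.\<close>
    have "(real n / real 4) ^ 4 \<le> real (n choose 4)"
      using k large by (intro binomial_ge_n_over_k_pow_k) simp
    also have "\<dots> \<le> ?K" using k large by (intro of_nat_mono binomial_mono) auto
    finally have "real n ^ 4 / 256 \<le> ?K" by (simp add: power_divide)
    moreover have "0 < real n ^ 4 / 256" using n by simp
    ultimately have "1 / ?K \<le> 1 / (real n ^ 4 / 256)" by (intro frac_le) linarith+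
    then have "(1 / ?K) ^ m \<le> (256 / real n ^ 4) ^ m" by (intro power_mono) auto
    with large have "?c ^ 3 * (?c / ?K) ^ m \<le> (256 / real n ^ 4) ^ m" by simp
    then show ?thesis using nonneg(1) by linarith
  next
    case slack
    have "n choose 1 \<le> n choose r" using k slack by (intro binomial_mono) auto
    then have nc: "real n \<le> ?c" by simp
    then have c1: "1 \<le> ?c" using n by linarith
    \<comment> \<open>Four of the eight powers cancel the c^4 collected below, with c = C(n, r);
      since c \<ge> n, the other four give n^(-4m).\<close>
    have "real ((n choose r) ^ 8) \<le> ?K"
      using k slack by (intro of_nat_mono binomial_power_le_binomial) auto
    then have K: "?c ^ 8 \<le> ?K" by simp
    have K0: "0 < ?c ^ 8" using c1 by (intro zero_less_power) linarith
    \<comment> \<open>For m \<ge> 1 the cube fits under the exponent \<open>m\<close>.\<close>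
    have "?c ^ 3 * (?c / ?K) ^ m \<le> (?c ^ 3) ^ m * (?c / ?K) ^ m"
      using c1 assms(2) power_increasing[of 1 m "?c ^ 3"] by (intro mult_right_mono) auto
    also have "\<dots> = (?c ^ 4 / ?K) ^ m"
      by (simp add: power_mult_distrib[symmetric] power_Suc2[symmetric])
    also have "\<dots> \<le> (?c ^ 4 / ?c ^ 8) ^ m"
      using K K0 by (intro power_mono frac_le) simp_all
    also have "?c ^ 4 / ?c ^ 8 = 1 / ?c ^ 4"
    proof -
      have "x ^ 4 / x ^ 8 = 1 / x ^ 4" if "1 \<le> x" for x :: real
        using that by (simp add: field_simps power_add[symmetric])
      then show ?thesis using c1 .
    qed
    also have "(1 / ?c ^ 4) ^ m \<le> (256 / real n ^ 4) ^ m"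
      using nc n by (intro power_mono frac_le) auto
    finally show ?thesis using nonneg(1) by linarith
  qed
qed

text \<open>The 16 counts the \<open>s\<close> and \<open>t\<close> up to 3. The number of types is
  at most (n+1)^3 \<le> 8n^3, and n^3 \<le> n^(3m) reduces n^(-4m) to n^(-m).\<close>

lemma sum_compressed_types_le:
  assumes "m \<ge> 1" "n \<ge> 1"
  shows "(\<Sum>(s, t, r)\<in>compressed_types n. real (n choose r) ^ 3 * (real (n choose r) / real (n choose (s + t))) ^ m)
    \<le> (16 + 8 * 256 ^ m) * (1 / real n) ^ m"
proof -
  let ?T = "compressed_types n"
  let ?small = "\<lambda>(s, t, r). r = (0::nat) \<and> s + t \<le> (3::nat)"
  have n: "real n \<ge> 1" using assms by simp
  have "(\<Sum>(s, t, r)\<in>?T. real (n choose r) ^ 3 * (real (n choose r) / real (n choose (s + t))) ^ m)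
      \<le> (\<Sum>x\<in>?T. of_bool (?small x) * (1 / real n) ^ m + (256 / real n ^ 4) ^ m)"
  proof (rule sum_mono)
    fix x assume "x \<in> ?T"
    then show "(case x of (s, t, r) \<Rightarrow> real (n choose r) ^ 3 * (real (n choose r) / real (n choose (s + t))) ^ m)
        \<le> of_bool (?small x) * (1 / real n) ^ m + (256 / real n ^ 4) ^ m"
      using compressed_type_term_le[OF _ assms(1)] by (cases x) (simp only: prod.case)
  qed
  also have "\<dots> = real (card {x \<in> ?T. ?small x}) * (1 / real n) ^ m + real (card ?T) * (256 / real n ^ 4) ^ m"
    using finite_compressed_types[of n]
    by (simp add: sum.distrib sum_distrib_right[symmetric] Int_def)
  also have "\<dots> \<le> 16 * (1 / real n) ^ m + (8 * real n ^ 3) * (256 / real n ^ 4) ^ m"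
  proof (intro add_mono mult_right_mono)
    have "card {x \<in> ?T. ?small x} \<le> card ({..3::nat} \<times> {..3::nat} \<times> {0::nat})"
      by (rule card_mono) auto
    then show "real (card {x \<in> ?T. ?small x}) \<le> 16" by (simp add: card_cartesian_product)
    have "card ?T \<le> card ({..n} \<times> {..n} \<times> {..n})"
      by (rule card_mono[OF _ compressed_types_subset]) simp
    also have "\<dots> = (n + 1) ^ 3" by (simp add: card_cartesian_product power3_eq_cube)
    also have "\<dots> \<le> (2 * n) ^ 3" using assms(2) by (intro power_mono) auto
    finally have "real (card ?T) \<le> real ((2 * n) ^ 3)" by (rule of_nat_mono)
    then show "real (card ?T) \<le> 8 * real n ^ 3" by (simp add: power_mult_distrib)
  qed (use n in auto)
  also have "real n ^ 3 \<le> (real n ^ 3) ^ m"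
    using n assms(1) power_increasing[of 1 m "real n ^ 3"] by simp
  then have "(8 * real n ^ 3) * (256 / real n ^ 4) ^ m \<le> 8 * ((real n ^ 3) ^ m * (256 / real n ^ 4) ^ m)"
    using n by (simp add: mult_right_mono)
  also have "(real n ^ 3) ^ m * (256 / real n ^ 4) ^ m = (256 * (1 / real n)) ^ m"
  proof -
    have "real n ^ 3 * (256 / real n ^ 4) = 256 * (1 / real n)"
      using n by (simp add: field_simps power_Suc[symmetric])
    then show ?thesis by (simp only: power_mult_distrib[symmetric])
  qed
  also have "(256 * (1 / real n)) ^ m = 256 ^ m * (1 / real n) ^ m"
    by (rule power_mult_distrib)
  finally show ?thesis by (simp only: distrib_right mult.assoc)
qed

theorem theorem12p3:
  fixes \<epsilon> :: real and d :: nat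
  assumes "\<epsilon> > 0" and "even d" and "d \<ge> 4"
  shows "\<exists>\<gamma> > 0. (\<lambda>n. 1 - measure_pmf.prob (random_graph n d) {G. spreader \<gamma> (shape G)})
           \<in> O(\<lambda>n. real n powr (- real_of_int (tau_fund d)))"
proof (intro exI conjI)
  define m where "m = d div 2 - 1"
  have m: "m \<ge> 1" "d div 2 = Suc m" using assms(3) by (auto simp: m_def)
  show "(\<lambda>n. 1 - measure_pmf.prob (random_graph n d) {G. spreader (1 / 72) (shape G)})
      \<in> O(\<lambda>n. real n powr (- real_of_int (tau_fund d)))"
  \<comment> \<open>The constant depends on \<open>d\<close> only.\<close>
  proof (rule bigoI[where c = "16 + 8 * 256 ^ m"])
    show "\<forall>\<^sub>F n in at_top. norm (1 - measure_pmf.prob (random_graph n d) {G. spreader (1 / 72) (shape G)})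
        \<le> (16 + 8 * 256 ^ m) * norm (real n powr (- real_of_int (tau_fund d)))"
      using eventually_ge_at_top[of 1]
    proof eventually_elim
      case (elim n)
      let ?p = "1 - measure_pmf.prob (random_graph n d) {G. spreader (1 / 72) (shape G)}"
      have "?p \<le> (\<Sum>(A, B)\<in>compressed_pairs {1..n}. (real (card (trapping {1..n} A B)) / fact n) ^ Suc m)"
        using prob_not_spreader_le[of d n] assms(3) m(2) by simp
      also have "\<dots> \<le> (16 + 8 * 256 ^ m) * (1 / real n) ^ m"
        using sum_compressed_pairs_le[of "{1..n}" m] sum_compressed_types_le[OF m(1) elim] by simp
      also have "\<dots> \<le> (16 + 8 * 256 ^ m) * real n powr (- real_of_int (tau_fund d))"
      proof (rule mult_left_mono)
        \<comment> \<open>An upper bound on \<open>tau_fund d\<close> is the useful direction: for n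
          \<ge> 1 it makes n^(-m) the smaller power.\<close>
        have "tau_fund d \<le> int m" using tau_fund_le[of d] assms(2,3) m by simp
        then have "real n powr (- real m) \<le> real n powr (- real_of_int (tau_fund d))"
          using elim by (intro powr_mono) linarith+
        moreover have "(1 / real n) ^ m = real n powr (- real m)"
          using elim by (simp add: powr_minus powr_realpow power_one_over divide_inverse power_inverse)
        ultimately show "(1 / real n) ^ m \<le> real n powr (- real_of_int (tau_fund d))" by simp
      qed simp
      finally have "?p \<le> (16 + 8 * 256 ^ m) * real n powr (- real_of_int (tau_fund d))" .
      then show ?case by simp
    qed
  qed
qed simp

end
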